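(* Let $M$ be a Malcev algebra over a field of characteristic not $2$, and let $r\in(\mathrm{id}-\tau)(M\otimes M)$ be a solution to the classical Yang-Baxter equation $C_M(r)=0$ on $M$. Then the pair $(M,\Delta_r)$ is a Malcev bialgebra.
   Context: A Malcev algebra is an anticommutative algebra satisfying $J(x,y,xz)=J(x,y,z)x$, where $J(x,y,z)=(xy)z+(yz)x+(zx)y$. $\tau$ is the flip $\tau(u\otimes v)=v\otimes u$ on $M\otimes M$. For $r=\sum_i a_i\otimes b_i\in M\otimes M$ define $\Delta_r:M\to M\otimes M$ by $\Delta_r(a)=\sum_i (a_ia\otimes b_i-a_i\otimes ab_i)$, and $$C_M(r)=\sum_{i,j}\bigl(a_ia_j\otimes b_i\otimes b_j-a_i\otimes a_jb_i\otimes b_j+a_i\otimes a_j\otimes b_ib_j\bigr)\in M\otimes M\otimes M.$$ Malcev bialgebra: given an algebra $A$ with a linear map $\Delta:A\to A\otimes A$, $\Delta(a)=\sum a_{(1)}\otimes a_{(2)}$, the dual algebra is $A^*$ with product $\langle fg,a\rangle=\sum\langle f,a_{(1)}\rangle\langle g,a_{(2)}\rangle$. The Drinfeld double is $D(A)=A\oplus A^*$ with product $(a+f)(b+g)=(ab+f\rightharpoonup b+a\leftharpoonup g)+(fg+f\leftharpoondown b+a\rightharpoondown g)$, where $f\rightharpoonup a=\sum a_{(1)}\langle f,a_{(2)}\rangle$, $a\leftharpoonup f=\sum\langle f,a_{(1)}\rangle a_{(2)}$, $\langle f\leftharpoondown a,b\rangle=\langle f,ab\rangle$, $\langle b\rightharpoondown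 f,a\rangle=\langle f,ab\rangle$. For a Malcev algebra $M$ with comultiplication $\Delta$, $(M,\Delta)$ is a Malcev bialgebra if $D(M)$ is a Malcev algebra. *)

theory Defs
  imports
    Complex_Main
    "HOL-Library.Poly_Mapping"
    "HOL-Library.Function_Algebras"
    "HOL-Library.Product_Plus"
begin

section \<open>Free vector spaces\<close>

text \<open>The free vector space over a field \<open>'k\<close> on a set \<open>'x\<close> is \<open>'x \<Rightarrow>\<^sub>0 'k\<close>.\<close>

definition free_scale :: "'k::field \<Rightarrow> ('x \<Rightarrow>\<^sub>0 'k) \<Rightarrow> ('x \<Rightarrow>\<^sub>0 'k)"
  where "free_scale c t = Poly_Mapping.map ((*) c) t"

lemma lookup_free_scale [simp]: "Poly_Mapping.lookup (free_scale c t) x = c * Poly_Mapping.lookup t x"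
  by (simp add: free_scale_def map.rep_eq when_def)

global_interpretation free: vector_space free_scale
  by unfold_locales (auto intro!: poly_mapping_eqI simp: lookup_add algebra_simps)

lemma free_scale_single [simp]:
  "free_scale c (Poly_Mapping.single x d) = Poly_Mapping.single x (c * d)"
  by (intro poly_mapping_eqI) (simp add: lookup_single when_def)

abbreviation basis :: "'x \<Rightarrow> ('x \<Rightarrow>\<^sub>0 'k::field)"
  where "basis x \<equiv> Poly_Mapping.single x 1"

text \<open>The linear extension of a map given on the basis \<open>'x\<close>; \<open>scale\<close> belongs to the target space.\<close>

definition lin_ext :: "('k::field \<Rightarrow> 'v::ab_group_add \<Rightarrow> 'v) \<Rightarrow> ('x \<Rightarrow> 'v) \<Rightarrow> ('x \<Rightarrow>\<^sub>0 'k) \<Rightarrow> 'v"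
  where "lin_ext scale f t = (\<Sum>x\<in>Poly_Mapping.keys t. scale (Poly_Mapping.lookup t x) (f x))"


section \<open>Quotient spaces\<close>

definition coset :: "'v::ab_group_add set \<Rightarrow> 'v \<Rightarrow> 'v set"
  where "coset W t = {s. s - t \<in> W}"

definition quotient_space :: "'v::ab_group_add set \<Rightarrow> 'v set set"
  where "quotient_space W = range (coset W)"

text \<open>Operations on cosets are defined by acting on all representatives; each union is a single
  coset when the operation is well defined modulo \<open>W\<close>.\<close>

definition coset_map :: "'w::ab_group_add set \<Rightarrow> ('v \<Rightarrow> 'w) \<Rightarrow> 'v set \<Rightarrow> 'w set"
  where "coset_map W f X = (\<Union>x\<in>X. coset W (f x))"

definition coset_add :: "'v::ab_group_add set \<Rightarrow> 'v set \<Rightarrow> 'v set \<Rightarrow> 'v set"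
  where "coset_add W X Y = (\<Union>x\<in>X. \<Union>y\<in>Y. coset W (x + y))"

definition coset_diff :: "'v::ab_group_add set \<Rightarrow> 'v set \<Rightarrow> 'v set \<Rightarrow> 'v set"
  where "coset_diff W X Y = (\<Union>x\<in>X. \<Union>y\<in>Y. coset W (x - y))"

text \<open>The common value on a coset of a map that factors through the quotient.\<close>

definition coset_value :: "('v \<Rightarrow> 'w) \<Rightarrow> 'v set \<Rightarrow> 'w"
  where "coset_value f X = the_elem (f ` X)"


section \<open>Tensor powers\<close>

text \<open>\<open>M \<otimes> M\<close> and \<open>M \<otimes> M \<otimes> M\<close> are the quotients of the free vector spaces on \<open>M \<times> M\<close> and
  \<open>M \<times> M \<times> M\<close> by the multilinearity relations; \<open>a \<otimes> b\<close> is the coset of \<open>basis (a, b)\<close>.\<close>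

definition null2 :: "('k::field \<Rightarrow> 'm::ab_group_add \<Rightarrow> 'm) \<Rightarrow> (('m \<times> 'm) \<Rightarrow>\<^sub>0 'k) set"
  where "null2 scale = free.span (
      {basis (a + a', b) - basis (a, b) - basis (a', b) | a a' b. True}
    \<union> {basis (a, b + b') - basis (a, b) - basis (a, b') | a b b'. True}
    \<union> {basis (scale c a, b) - free_scale c (basis (a, b)) | c a b. True}
    \<union> {basis (a, scale c b) - free_scale c (basis (a, b)) | c a b. True})"

definition null3 :: "('k::field \<Rightarrow> 'm::ab_group_add \<Rightarrow> 'm) \<Rightarrow> (('m \<times> 'm \<times> 'm) \<Rightarrow>\<^sub>0 'k) set"
  where "null3 scale = free.span (
      {basis (a + a', b, c) - basis (a, b, c) - basis (a', b, c) | a a' b c. True}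
    \<union> {basis (a, b + b', c) - basis (a, b, c) - basis (a, b', c) | a b b' c. True}
    \<union> {basis (a, b, c + c') - basis (a, b, c) - basis (a, b, c') | a b c c'. True}
    \<union> {basis (scale k a, b, c) - free_scale k (basis (a, b, c)) | k a b c. True}
    \<union> {basis (a, scale k b, c) - free_scale k (basis (a, b, c)) | k a b c. True}
    \<union> {basis (a, b, scale k c) - free_scale k (basis (a, b, c)) | k a b c. True})"

type_synonym ('m, 'k) tensor2 = "(('m \<times> 'm) \<Rightarrow>\<^sub>0 'k) set"
type_synonym ('m, 'k) tensor3 = "(('m \<times> 'm \<times> 'm) \<Rightarrow>\<^sub>0 'k) set"

definition tensor2 :: "('k::field \<Rightarrow> 'm::ab_group_add \<Rightarrow> 'm) \<Rightarrow> ('m, 'k) tensor2 set"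
  where "tensor2 scale = quotient_space (null2 scale)"

definition flip ::
  "('k::field \<Rightarrow> 'm::ab_group_add \<Rightarrow> 'm) \<Rightarrow> ('m, 'k) tensor2 \<Rightarrow> ('m, 'k) tensor2"
  where "flip scale =
    coset_map (null2 scale) (lin_ext free_scale (\<lambda>(u, v). basis (v, u)))"

definition linear_comult ::
  "('k::field \<Rightarrow> 'm::ab_group_add \<Rightarrow> 'm) \<Rightarrow> ('m \<Rightarrow> ('m, 'k) tensor2) \<Rightarrow> bool"
  where "linear_comult scale \<Delta> \<longleftrightarrow>
    (\<forall>a. \<Delta> a \<in> tensor2 scale) \<and>
    (\<forall>a b. \<Delta> (a + b) = coset_add (null2 scale) (\<Delta> a) (\<Delta> b)) \<and>
    (\<forall>c a. \<Delta> (scale c a) = coset_map (null2 scale) (free_scale c) (\<Delta> a))"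


section \<open>Malcev algebras\<close>

text \<open>The underlying space is a linear subspace \<open>A\<close> of an ambient vector space, so that the notion
  also applies to the double, whose second summand is the set of linear functionals inside the
  space of all functions.\<close>

locale nonassoc_algebra = vector_space scale
  for scale :: "'k::field \<Rightarrow> 'v::ab_group_add \<Rightarrow> 'v" +
  fixes A :: "'v set" and mult :: "'v \<Rightarrow> 'v \<Rightarrow> 'v"
  assumes subspace_carrier: "subspace A"
    and mult_closed: "x \<in> A \<Longrightarrow> y \<in> A \<Longrightarrow> mult x y \<in> A"
    and mult_add_left: "x \<in> A \<Longrightarrow> y \<in> A \<Longrightarrow> z \<in> A \<Longrightarrow> mult (x + y) z = mult x z + mult y z"
    and mult_add_right: "x \<in> A \<Longrightarrow> y \<in> A \<Longrightarrow> z \<in> A \<Longrightarrow> mult x (y + z) = mult x y + mult x z"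
    and mult_scale_left: "x \<in> A \<Longrightarrow> y \<in> A \<Longrightarrow> mult (scale c x) y = scale c (mult x y)"
    and mult_scale_right: "x \<in> A \<Longrightarrow> y \<in> A \<Longrightarrow> mult x (scale c y) = scale c (mult x y)"

definition jacobian :: "('v \<Rightarrow> 'v \<Rightarrow> 'v) \<Rightarrow> 'v \<Rightarrow> 'v \<Rightarrow> 'v \<Rightarrow> 'v::ab_group_add"
  where "jacobian mult x y z = mult (mult x y) z + mult (mult y z) x + mult (mult z x) y"

locale malcev_algebra = nonassoc_algebra +
  assumes anticommutative: "x \<in> A \<Longrightarrow> y \<in> A \<Longrightarrow> mult x y = - mult y x"
    and malcev: "x \<in> A \<Longrightarrow> y \<in> A \<Longrightarrow> z \<in> A \<Longrightarrow>
      jacobian mult x y (mult x z) = mult (jacobian mult x y z) x"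


section \<open>The Drinfeld double and Malcev bialgebras\<close>

definition dual :: "('k::field \<Rightarrow> 'm::ab_group_add \<Rightarrow> 'm) \<Rightarrow> ('m \<Rightarrow> 'k) set"
  where "dual scale = {f. Vector_Spaces.linear scale (*) f}"

definition dual_mult :: "('m \<Rightarrow> ('m, 'k::field) tensor2) \<Rightarrow> ('m \<Rightarrow> 'k) \<Rightarrow> ('m \<Rightarrow> 'k) \<Rightarrow> ('m \<Rightarrow> 'k)"
  where "dual_mult \<Delta> f g = (\<lambda>a. coset_value (lin_ext (*) (\<lambda>(u, v). f u * g v)) (\<Delta> a))"

text \<open>\<open>contract_right\<close> is \<open>f \<rightharpoonup> a = \<Sum> a\<^sub>(\<^sub>1\<^sub>) \<langle>f, a\<^sub>(\<^sub>2\<^sub>)\<rangle>\<close> and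
  \<open>contract_left\<close> is \<open>a \<leftharpoonup> f = \<Sum> \<langle>f, a\<^sub>(\<^sub>1\<^sub>)\<rangle> a\<^sub>(\<^sub>2\<^sub>)\<close>.\<close>

definition contract_right ::
  "('k::field \<Rightarrow> 'm::ab_group_add \<Rightarrow> 'm) \<Rightarrow> ('m \<Rightarrow> ('m, 'k) tensor2) \<Rightarrow> ('m \<Rightarrow> 'k) \<Rightarrow> 'm \<Rightarrow> 'm"
  where "contract_right scale \<Delta> f a =
    coset_value (lin_ext scale (\<lambda>(u, v). scale (f v) u)) (\<Delta> a)"

definition contract_left ::
  "('k::field \<Rightarrow> 'm::ab_group_add \<Rightarrow> 'm) \<Rightarrow> ('m \<Rightarrow> ('m, 'k) tensor2) \<Rightarrow> 'm \<Rightarrow> ('m \<Rightarrow> 'k) \<Rightarrow> 'm"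
  where "contract_left scale \<Delta> a f =
    coset_value (lin_ext scale (\<lambda>(u, v). scale (f u) v)) (\<Delta> a)"

text \<open>\<open>coact_right mult f a\<close> is \<open>f \<leftharpoondown> a\<close> and \<open>coact_left mult a f\<close> is \<open>a \<rightharpoondown> f\<close>.\<close>

definition coact_right :: "('m \<Rightarrow> 'm \<Rightarrow> 'm) \<Rightarrow> ('m \<Rightarrow> 'k) \<Rightarrow> 'm \<Rightarrow> ('m \<Rightarrow> 'k)"
  where "coact_right mult f a = (\<lambda>b. f (mult a b))"

definition coact_left :: "('m \<Rightarrow> 'm \<Rightarrow> 'm) \<Rightarrow> 'm \<Rightarrow> ('m \<Rightarrow> 'k) \<Rightarrow> ('m \<Rightarrow> 'k)"
  where "coact_left mult b f = (\<lambda>a. f (mult a b))"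

definition double_scale ::
  "('k::field \<Rightarrow> 'm \<Rightarrow> 'm) \<Rightarrow> 'k \<Rightarrow> 'm \<times> ('m \<Rightarrow> 'k) \<Rightarrow> 'm \<times> ('m \<Rightarrow> 'k)"
  where "double_scale scale c = (\<lambda>(a, f). (scale c a, \<lambda>x. c * f x))"

definition double_carrier ::
  "('k::field \<Rightarrow> 'm::ab_group_add \<Rightarrow> 'm) \<Rightarrow> ('m \<times> ('m \<Rightarrow> 'k)) set"
  where "double_carrier scale = UNIV \<times> dual scale"

definition double_mult ::
  "('k::field \<Rightarrow> 'm::ab_group_add \<Rightarrow> 'm) \<Rightarrow> ('m \<Rightarrow> 'm \<Rightarrow> 'm) \<Rightarrow> ('m \<Rightarrow> ('m, 'k) tensor2) \<Rightarrow>
    'm \<times> ('m \<Rightarrow> 'k) \<Rightarrow> 'm \<times> ('m \<Rightarrow> 'k) \<Rightarrow> 'm \<times> ('m \<Rightarrow> 'k)"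
  where "double_mult scale mult \<Delta> = (\<lambda>(a, f) (b, g).
    (mult a b + contract_right scale \<Delta> f b + contract_left scale \<Delta> a g,
     dual_mult \<Delta> f g + coact_right mult f b + coact_left mult a g))"

definition malcev_bialgebra ::
  "('k::field \<Rightarrow> 'm::ab_group_add \<Rightarrow> 'm) \<Rightarrow> ('m \<Rightarrow> 'm \<Rightarrow> 'm) \<Rightarrow> ('m \<Rightarrow> ('m, 'k) tensor2) \<Rightarrow> bool"
  where "malcev_bialgebra scale mult \<Delta> \<longleftrightarrow>
    malcev_algebra scale UNIV mult \<and>
    linear_comult scale \<Delta> \<and>
    malcev_algebra (double_scale scale) (double_carrier scale) (double_mult scale mult \<Delta>)"


section \<open>The comultiplication and the Yang-Baxter element of a tensor\<close>

definition comult_of ::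
  "('k::field \<Rightarrow> 'm::ab_group_add \<Rightarrow> 'm) \<Rightarrow> ('m \<Rightarrow> 'm \<Rightarrow> 'm) \<Rightarrow> ('m, 'k) tensor2 \<Rightarrow>
    'm \<Rightarrow> ('m, 'k) tensor2"
  where "comult_of scale mult r a = coset_map (null2 scale)
    (lin_ext free_scale (\<lambda>(u, v). basis (mult u a, v) - basis (u, mult a v))) r"

text \<open>On a representative \<open>t\<close> of \<open>r\<close>, the outer extension runs over the index \<open>i\<close> and the inner one
  over \<open>j\<close>.\<close>

definition cybe_rep ::
  "('m \<Rightarrow> 'm \<Rightarrow> 'm) \<Rightarrow> (('m \<times> 'm) \<Rightarrow>\<^sub>0 'k::field) \<Rightarrow> (('m \<times> 'm \<times> 'm) \<Rightarrow>\<^sub>0 'k)"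
  where "cybe_rep mult t = lin_ext free_scale (\<lambda>(ai, bi).
    lin_ext free_scale (\<lambda>(aj, bj).
      basis (mult ai aj, bi, bj) - basis (ai, mult aj bi, bj)
        + basis (ai, aj, mult bi bj)) t) t"

definition cybe ::
  "('k::field \<Rightarrow> 'm::ab_group_add \<Rightarrow> 'm) \<Rightarrow> ('m \<Rightarrow> 'm \<Rightarrow> 'm) \<Rightarrow> ('m, 'k) tensor2 \<Rightarrow> ('m, 'k) tensor3"
  where "cybe scale mult r = coset_map (null3 scale) (cybe_rep mult) r"


section \<open>Formulas in terms of a presentation\<close>

text \<open>The operations above are well defined: on a tensor presented as a finite sum
  \<open>\<Sum>i\<in>I. x i \<otimes> y i\<close> they are given by the expected sums, whatever the presentation.\<close>

context vector_space
begin

lemma lin_ext_superset: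
  assumes "finite K" "Poly_Mapping.keys t \<subseteq> K"
  shows "lin_ext scale f t = (\<Sum>x\<in>K. Poly_Mapping.lookup t x *s f x)"
  unfolding lin_ext_def using assms
  by (intro sum.mono_neutral_left) (auto simp: in_keys_iff)

lemma lin_ext_add: "lin_ext scale f (s + t) = lin_ext scale f s + lin_ext scale f t"
proof -
  let ?K = "Poly_Mapping.keys s \<union> Poly_Mapping.keys t"
  have "finite ?K" "Poly_Mapping.keys (s + t) \<subseteq> ?K"
    using Poly_Mapping.keys_add[of s t] by auto
  then show ?thesis
    by (simp add: lin_ext_superset[of ?K] lookup_add scale_left_distrib sum.distrib)
qed

lemma lin_ext_scale: "lin_ext scale f (free_scale c t) = c *s lin_ext scale f t"
proof -
  have "Poly_Mapping.keys (free_scale c t) \<subseteq> Poly_Mapping.keys t"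
    by (auto simp: in_keys_iff)
  then show ?thesis
    by (simp add: lin_ext_superset[of "Poly_Mapping.keys t"] scale_sum_right)
qed

lemma lin_ext_0: "lin_ext scale f 0 = 0"
  by (simp add: lin_ext_def)

lemma lin_ext_diff: "lin_ext scale f (s - t) = lin_ext scale f s - lin_ext scale f t"
  using lin_ext_add[of f "s - t" t] by simp

lemma lin_ext_sum: "lin_ext scale f (\<Sum>i\<in>I. t i) = (\<Sum>i\<in>I. lin_ext scale f (t i))"
  by (induction I rule: infinite_finite_induct) (auto simp: lin_ext_0 lin_ext_add)

lemma lin_ext_basis [simp]: "lin_ext scale f (basis x) = f x"
  by (simp add: lin_ext_def)

end

lemma mem_coset_iff: "s \<in> coset W t \<longleftrightarrow> s - t \<in> W"
  by (simp add: coset_def)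

lemma coset_cong:
  assumes "module.subspace scale W" "module scale" "s - t \<in> W"
  shows "coset W s = coset W t"
proof -
  interpret module scale by fact
  have "u - s \<in> W \<longleftrightarrow> u - t \<in> W" for u
  proof
    assume "u - s \<in> W"
    from subspace_add[OF assms(1) this assms(3)] show "u - t \<in> W" by simp
  next
    assume "u - t \<in> W"
    from subspace_diff[OF assms(1) this assms(3)] show "u - s \<in> W" by simp
  qed
  then show ?thesis by (simp add: coset_def)
qed

lemma coset_map_coset:
  assumes "module scale" "module.subspace scale W'" "0 \<in> W"
    and "\<And>s. s - t \<in> W \<Longrightarrow> f s - f t \<in> W'"
  shows "coset_map W' f (coset W t) = coset W' (f t)"
proof -
  have "coset W' (f s) = coset W' (f t)" if "s \<in> coset W t" for s
    using coset_cong[OF assms(2,1)] assms(4) that by (simp add: mem_coset_iff)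
  moreover have "t \<in> coset W t" using assms(3) by (simp add: mem_coset_iff)
  ultimately show ?thesis unfolding coset_map_def by blast
qed

lemma coset_value_coset:
  assumes "0 \<in> W" and "\<And>s. s - t \<in> W \<Longrightarrow> f s = f t"
  shows "coset_value f (coset W t) = f t"
proof -
  have "t \<in> coset W t" using assms(1) by (simp add: mem_coset_iff)
  moreover have "f s = f t" if "s \<in> coset W t" for s
    using that by (intro assms(2)) (simp only: mem_coset_iff)
  ultimately have "f ` coset W t = {f t}" by blast
  then show ?thesis by (simp add: coset_value_def)
qed

lemma subspace_null2: "free.subspace (null2 scale)"
  unfolding null2_def by (rule free.subspace_span)

lemma subspace_null3: "free.subspace (null3 scale)"
  unfolding null3_def by (rule free.subspace_span)

lemma null2_add_left:
  "basis (a + a', b) - basis (a, b) - basis (a', b) \<in> null2 scale"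
  unfolding null2_def
  by (rule free.span_base, rule UnI1, rule UnI1, rule UnI1, rule CollectI, intro exI conjI, rule refl, rule TrueI)

lemma null2_add_right:
  "basis (a, b + b') - basis (a, b) - basis (a, b') \<in> null2 scale"
  unfolding null2_def
  by (rule free.span_base, rule UnI1, rule UnI1, rule UnI2, rule CollectI, intro exI conjI, rule refl, rule TrueI)

lemma null2_scale_left:
  "basis (scale c a, b) - free_scale c (basis (a, b)) \<in> null2 scale"
  unfolding null2_def
  by (rule free.span_base, rule UnI1, rule UnI2, rule CollectI, intro exI conjI, rule refl, rule TrueI)

lemma null2_scale_right:
  "basis (a, scale c b) - free_scale c (basis (a, b)) \<in> null2 scale"
  unfolding null2_def
  by (rule free.span_base, rule UnI2, rule CollectI, intro exI conjI, rule refl, rule TrueI)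

lemma null3_add1:
  "basis (a + a', b, c) - basis (a, b, c) - basis (a', b, c) \<in> null3 scale"
  unfolding null3_def
  by (rule free.span_base, rule UnI1, rule UnI1, rule UnI1, rule UnI1, rule UnI1, rule CollectI, intro exI conjI, rule refl, rule TrueI)

lemma null3_add2:
  "basis (a, b + b', c) - basis (a, b, c) - basis (a, b', c) \<in> null3 scale"
  unfolding null3_def
  by (rule free.span_base, rule UnI1, rule UnI1, rule UnI1, rule UnI1, rule UnI2, rule CollectI, intro exI conjI, rule refl, rule TrueI)

lemma null3_add3:
  "basis (a, b, c + c') - basis (a, b, c) - basis (a, b, c') \<in> null3 scale"
  unfolding null3_def
  by (rule free.span_base, rule UnI1, rule UnI1, rule UnI1, rule UnI2, rule CollectI, intro exI conjI, rule refl, rule TrueI)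

lemma null3_scale1:
  "basis (scale k a, b, c) - free_scale k (basis (a, b, c)) \<in> null3 scale"
  unfolding null3_def
  by (rule free.span_base, rule UnI1, rule UnI1, rule UnI2, rule CollectI, intro exI conjI, rule refl, rule TrueI)

lemma null3_scale2:
  "basis (a, scale k b, c) - free_scale k (basis (a, b, c)) \<in> null3 scale"
  unfolding null3_def
  by (rule free.span_base, rule UnI1, rule UnI2, rule CollectI, intro exI conjI, rule refl, rule TrueI)

lemma null3_scale3:
  "basis (a, b, scale k c) - free_scale k (basis (a, b, c)) \<in> null3 scale"
  unfolding null3_def
  by (rule free.span_base, rule UnI2, rule CollectI, intro exI conjI, rule refl, rule TrueI)

lemma tensor2_presentation:
  assumes "r \<in> tensor2 scale"
  obtains I :: "('m::ab_group_add \<times> 'm) set" and x y :: "'m \<times> 'm \<Rightarrow> 'm"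
  where "finite I"
    and "r = coset (null2 (scale :: 'k::field \<Rightarrow> 'm \<Rightarrow> 'm)) (\<Sum>i\<in>I. basis (x i, y i))"
proof -
  obtain t where t: "r = coset (null2 scale) t"
    using assms by (auto simp: tensor2_def quotient_space_def)
  let ?I = "Poly_Mapping.keys t" and ?x = "\<lambda>p. scale (Poly_Mapping.lookup t p) (fst p)"
  have "basis (?x p, snd p) - Poly_Mapping.single p (Poly_Mapping.lookup t p) \<in> null2 scale" for p
  proof -
    have "basis (scale (Poly_Mapping.lookup t p) (fst p), snd p)
        - free_scale (Poly_Mapping.lookup t p) (basis (fst p, snd p)) \<in> null2 scale"
      by (rule null2_scale_left)
    then show ?thesis by simp
  qed
  then have "(\<Sum>p\<in>?I. basis (?x p, snd p) - Poly_Mapping.single p (Poly_Mapping.lookup t p))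
      \<in> null2 scale"
    by (intro free.subspace_sum subspace_null2)
  moreover have "(\<Sum>p\<in>?I. Poly_Mapping.single p (Poly_Mapping.lookup t p)) = t"
    by (rule poly_mapping_eqI)
      (simp add: lookup_sum lookup_single when_def in_keys_iff)
  ultimately have "(\<Sum>p\<in>?I. basis (?x p, snd p)) - t \<in> null2 scale"
    by (simp only: sum_subtractf)
  from coset_cong[OF subspace_null2 free.module_axioms this]
  have "r = coset (null2 scale) (\<Sum>p\<in>?I. basis (?x p, snd p))"
    unfolding t by (rule sym)
  from that[OF finite_keys this] show ?thesis .
qed

text \<open>The universal property of \<open>M \<otimes> M\<close>, for maps that are bilinear modulo \<open>W\<close>.\<close>

lemma lin_ext_null2:
  assumes "vector_space scale'" "module.subspace scale' W"
    and "\<And>a a' b. f (a + a', b) - f (a, b) - f (a', b) \<in> W"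
    and "\<And>a b b'. f (a, b + b') - f (a, b) - f (a, b') \<in> W"
    and "\<And>c a b. f (scale c a, b) - scale' c (f (a, b)) \<in> W"
    and "\<And>a c b. f (a, scale c b) - scale' c (f (a, b)) \<in> W"
    and "w \<in> null2 scale"
  shows "lin_ext scale' f w \<in> W"
proof -
  interpret V: vector_space scale' by fact
  have "free.subspace {w. lin_ext scale' f w \<in> W}"
    using assms(2)
    by (auto simp: free.subspace_def V.subspace_def V.lin_ext_0 V.lin_ext_add V.lin_ext_scale)
  then have "null2 scale \<subseteq> {w. lin_ext scale' f w \<in> W}"
    unfolding null2_def
    by (intro free.span_minimal)
      (use assms(3-6) in \<open>auto simp: V.lin_ext_diff V.lin_ext_scale simp del: free_scale_single\<close>)
  then show ?thesis using assms(7) by blast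
qed

lemma coset_map_lin_ext:
  assumes "\<And>w. w \<in> null2 scale \<Longrightarrow> lin_ext free_scale f w \<in> null2 scale"
  shows "coset_map (null2 scale) (lin_ext free_scale f) (coset (null2 scale) t)
    = coset (null2 scale) (lin_ext free_scale f t)"
  by (rule coset_map_coset[OF free.module_axioms subspace_null2
        free.subspace_0[OF subspace_null2]])
    (simp only: free.lin_ext_diff[symmetric] assms)

lemma flip_presentation:
  "flip scale (coset (null2 scale) (\<Sum>i\<in>I. basis (x i, y i)))
    = coset (null2 scale) (\<Sum>i\<in>I. basis (y i, x i))"
proof -
  let ?f = "\<lambda>(u, v). basis (v, u)"
  have "lin_ext free_scale ?f w \<in> null2 scale" if "w \<in> null2 scale" for w
    by (rule lin_ext_null2[OF free.vector_space_axioms subspace_null2 _ _ _ _ that])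
      (auto intro: null2_add_left null2_add_right
        null2_scale_left null2_scale_right simp del: free_scale_single)
  then show ?thesis
    unfolding flip_def by (subst coset_map_lin_ext) (assumption, simp add: free.lin_ext_sum)
qed

lemma comult_of_presentation:
  assumes "nonassoc_algebra scale UNIV mult"
  shows "comult_of scale mult (coset (null2 scale) (\<Sum>i\<in>I. basis (x i, y i))) a
    = coset (null2 scale) (\<Sum>i\<in>I. basis (mult (x i) a, y i) - basis (x i, mult a (y i)))"
proof -
  interpret A: nonassoc_algebra scale UNIV mult by fact
  let ?f = "\<lambda>(u, v). basis (mult u a, v) - basis (u, mult a v)"
  have "lin_ext free_scale ?f w \<in> null2 scale" if "w \<in> null2 scale" for w
  proof (rule lin_ext_null2[OF free.vector_space_axioms subspace_null2 _ _ _ _ that])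
    fix u u' v v' c
    show "?f (u + u', v) - ?f (u, v) - ?f (u', v) \<in> null2 scale"
      using free.subspace_diff[OF subspace_null2 null2_add_left[of "mult u a" "mult u' a" v]
          null2_add_left[of u u' "mult a v"]]
      by (simp add: A.mult_add_left algebra_simps)
    show "?f (u, v + v') - ?f (u, v) - ?f (u, v') \<in> null2 scale"
      using free.subspace_diff[OF subspace_null2 null2_add_right[of "mult u a" v v']
          null2_add_right[of u "mult a v" "mult a v'"]]
      by (simp add: A.mult_add_right algebra_simps)
    show "?f (scale c u, v) - free_scale c (?f (u, v)) \<in> null2 scale"
      using free.subspace_diff[OF subspace_null2 null2_scale_left[of scale c "mult u a" v]
          null2_scale_left[of scale c u "mult a v"]]
      by (simp add: A.mult_scale_left free.scale_right_diff_distrib algebra_simps)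
    show "?f (u, scale c v) - free_scale c (?f (u, v)) \<in> null2 scale"
      using free.subspace_diff[OF subspace_null2 null2_scale_right[of "mult u a" scale c v]
          null2_scale_right[of u scale c "mult a v"]]
      by (simp add: A.mult_scale_right free.scale_right_diff_distrib algebra_simps)
  qed
  then show ?thesis
    unfolding comult_of_def by (subst coset_map_lin_ext) (assumption, simp add: free.lin_ext_sum)
qed

lemma coset_value_lin_ext:
  assumes "vector_space scale'" and "\<And>w. w \<in> null2 scale \<Longrightarrow> lin_ext scale' f w = 0"
  shows "coset_value (lin_ext scale' f) (coset (null2 scale) t) = lin_ext scale' f t"
proof (rule coset_value_coset[OF free.subspace_0[OF subspace_null2]])
  interpret V: vector_space scale' by fact
  fix s assume "s - t \<in> null2 scale"
  from assms(2)[OF this] show "lin_ext scale' f s = lin_ext scale' f t"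
    by (simp add: V.lin_ext_diff)
qed

lemma vector_space_field: "vector_space ((*) :: 'k::field \<Rightarrow> 'k \<Rightarrow> 'k)"
  by unfold_locales (simp_all add: algebra_simps)

lemma
  assumes "f \<in> dual scale"
    and "\<Delta> a = coset (null2 scale) (\<Sum>i\<in>I. basis (x i, y i))"
  shows contract_right_presentation:
      "contract_right scale \<Delta> f a = (\<Sum>i\<in>I. scale (f (y i)) (x i))"
    and contract_left_presentation:
      "contract_left scale \<Delta> a f = (\<Sum>i\<in>I. scale (f (x i)) (y i))"
proof -
  interpret f: Vector_Spaces.linear scale "(*)" f
    using assms(1) by (simp add: dual_def)
  note vs = f.vs1.vector_space_axioms
  have "lin_ext scale (\<lambda>(u, v). scale (f v) u) w \<in> {0}" if "w \<in> null2 scale" for w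
    by (rule lin_ext_null2[OF vs _ _ _ _ _ that])
      (simp_all add: f.vs1.subspace_single_0 f.vs1.scale_right_distrib f.vs1.scale_left_distrib
        f.add f.scale mult.commute)
  then show "contract_right scale \<Delta> f a = (\<Sum>i\<in>I. scale (f (y i)) (x i))"
    unfolding contract_right_def assms(2)
    by (subst coset_value_lin_ext[OF vs]) (simp, simp add: f.vs1.lin_ext_sum)
  have "lin_ext scale (\<lambda>(u, v). scale (f u) v) w \<in> {0}" if "w \<in> null2 scale" for w
    by (rule lin_ext_null2[OF vs _ _ _ _ _ that])
      (simp_all add: f.vs1.subspace_single_0 f.vs1.scale_right_distrib f.vs1.scale_left_distrib
        f.add f.scale mult.commute)
  then show "contract_left scale \<Delta> a f = (\<Sum>i\<in>I. scale (f (x i)) (y i))"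
    unfolding contract_left_def assms(2)
    by (subst coset_value_lin_ext[OF vs]) (simp, simp add: f.vs1.lin_ext_sum)
qed

lemma dual_mult_presentation:
  fixes scale :: "'k::field \<Rightarrow> 'm::ab_group_add \<Rightarrow> 'm"
  assumes "f \<in> dual scale" "g \<in> dual scale"
    and "\<Delta> a = coset (null2 scale) (\<Sum>i\<in>I. basis (x i, y i))"
  shows "dual_mult \<Delta> f g a = (\<Sum>i\<in>I. f (x i) * g (y i))"
proof -
  interpret K: vector_space "(*) :: 'k \<Rightarrow> 'k \<Rightarrow> 'k" by (rule vector_space_field)
  interpret f: Vector_Spaces.linear scale "(*)" f using assms(1) by (simp add: dual_def)
  interpret g: Vector_Spaces.linear scale "(*)" g using assms(2) by (simp add: dual_def)
  have "lin_ext (*) (\<lambda>(u, v). f u * g v) w \<in> {0}" if "w \<in> null2 scale" for w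
    by (rule lin_ext_null2[OF K.vector_space_axioms _ _ _ _ _ that])
      (simp_all add: K.subspace_single_0 f.add f.scale g.add g.scale distrib_left distrib_right
        mult.assoc mult.left_commute del: K.scale_scale)
  then show ?thesis
    unfolding dual_mult_def assms(3)
    by (subst coset_value_lin_ext[OF K.vector_space_axioms]) (simp, simp only: K.lin_ext_sum K.lin_ext_basis prod.case)
qed

context
  fixes mult :: "'m::ab_group_add \<Rightarrow> 'm \<Rightarrow> 'm"
begin

private definition T :: "'m \<times> 'm \<Rightarrow> 'm \<times> 'm \<Rightarrow> (('m \<times> 'm \<times> 'm) \<Rightarrow>\<^sub>0 'k::field)"
  where "T = (\<lambda>(a, b) (c, d). basis (mult a c, b, d) - basis (a, mult c b, d)
    + basis (a, c, mult b d))"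

private lemma cybe_rep_T: "cybe_rep mult t = lin_ext free_scale (\<lambda>p. lin_ext free_scale (T p) t) t"
  by (simp add: cybe_rep_def T_def case_prod_unfold)

private lemma combine:
  assumes "X \<in> null3 scale" "Y \<in> null3 scale" "Z \<in> null3 scale" "D = X - Y + Z"
  shows "D \<in> null3 scale"
  unfolding assms(4)
  by (intro free.subspace_add[OF subspace_null3] free.subspace_diff[OF subspace_null3] assms(1-3))

lemma cybe_presentation:
  fixes scale :: "'k::field \<Rightarrow> 'm \<Rightarrow> 'm"
  assumes "nonassoc_algebra scale UNIV mult"
  shows "cybe scale mult (coset (null2 scale) (\<Sum>i\<in>I. basis (x i, y i)))
    = coset (null3 scale) (\<Sum>i\<in>I. \<Sum>j\<in>I. basis (mult (x i) (x j), y i, y j)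
        - basis (x i, mult (x j) (y i), y j) + basis (x i, x j, mult (y i) (y j)))"
proof -
  interpret A: nonassoc_algebra scale UNIV mult by fact
  note bil = A.mult_add_left A.mult_add_right A.mult_scale_left A.mult_scale_right
    free.scale_right_diff_distrib free.scale_right_distrib
  have right: "lin_ext free_scale (T p) w \<in> null3 scale"
    if w: "w \<in> null2 scale" for w p
  proof (rule lin_ext_null2[OF free.vector_space_axioms subspace_null3 _ _ _ _ w])
    obtain a b where p: "p = (a, b)" by fastforce
    fix u u' v v' :: 'm and c :: 'k
    show "T p (u + u', v) - T p (u, v) - T p (u', v) \<in> null3 scale"
      unfolding p by (rule combine[OF null3_add1[of "mult a u" "mult a u'" b v]
          null3_add2[of a "mult u b" "mult u' b" v]
          null3_add2[of a u u' "mult b v"]])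
        (simp add: T_def bil)
    show "T p (u, v + v') - T p (u, v) - T p (u, v') \<in> null3 scale"
      unfolding p by (rule combine[OF null3_add3[of "mult a u" b v v']
          null3_add3[of a "mult u b" v v']
          null3_add3[of a u "mult b v" "mult b v'"]])
        (simp add: T_def bil)
    show "T p (scale c u, v) - free_scale c (T p (u, v)) \<in> null3 scale"
      unfolding p by (rule combine[OF null3_scale1[of scale c "mult a u" b v]
          null3_scale2[of a scale c "mult u b" v]
          null3_scale2[of a scale c u "mult b v"]])
        (simp add: T_def bil)
    show "T p (u, scale c v) - free_scale c (T p (u, v)) \<in> null3 scale"
      unfolding p by (rule combine[OF null3_scale3[of "mult a u" b scale c v]
          null3_scale3[of a "mult u b" scale c v]
          null3_scale3[of a u scale c "mult b v"]])
        (simp add: T_def bil)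
  qed
  have left': "lin_ext free_scale (\<lambda>p. T p q) w \<in> null3 scale"
    if w: "w \<in> null2 scale" for w q
  proof (rule lin_ext_null2[OF free.vector_space_axioms subspace_null3 _ _ _ _ w])
    obtain a b where q: "q = (a, b)" by fastforce
    fix u u' v v' :: 'm and c :: 'k
    show "T (u + u', v) q - T (u, v) q - T (u', v) q \<in> null3 scale"
      unfolding q by (rule combine[OF null3_add1[of "mult u a" "mult u' a" v b]
          null3_add1[of u u' "mult a v" b]
          null3_add1[of u u' a "mult v b"]])
        (simp add: T_def bil)
    show "T (u, v + v') q - T (u, v) q - T (u, v') q \<in> null3 scale"
      unfolding q by (rule combine[OF null3_add2[of "mult u a" v v' b]
          null3_add2[of u "mult a v" "mult a v'" b]
          null3_add3[of u a "mult v b" "mult v' b"]])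
        (simp add: T_def bil)
    show "T (scale c u, v) q - free_scale c (T (u, v) q) \<in> null3 scale"
      unfolding q by (rule combine[OF null3_scale1[of scale c "mult u a" v b]
          null3_scale1[of scale c u "mult a v" b]
          null3_scale1[of scale c u a "mult v b"]])
        (simp add: T_def bil)
    show "T (u, scale c v) q - free_scale c (T (u, v) q) \<in> null3 scale"
      unfolding q by (rule combine[OF null3_scale2[of "mult u a" scale c v b]
          null3_scale2[of u scale c "mult a v" b]
          null3_scale3[of u a scale c "mult v b"]])
        (simp add: T_def bil)
  qed
  have ext_mem: "lin_ext free_scale F s \<in> null3 scale" if "\<And>p. F p \<in> null3 scale" for F s
    unfolding lin_ext_def
    by (intro free.subspace_sum free.subspace_scale subspace_null3 that)
  have swap: "lin_ext free_scale (\<lambda>p. lin_ext free_scale (T p) s) w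
      = lin_ext free_scale (\<lambda>q. lin_ext free_scale (\<lambda>p. T p q) w) s" for s w
    unfolding lin_ext_def free.scale_sum_right
    by (subst sum.swap) (simp only: free.scale_scale mult.commute)
  have well_def: "cybe_rep mult s - cybe_rep mult t \<in> null3 scale"
    if st: "s - t \<in> null2 scale" for s t
  proof -
    have "lin_ext free_scale (\<lambda>p. lin_ext free_scale (T p) s) (s - t) \<in> null3 scale"
      unfolding swap by (rule ext_mem, rule left', rule st)
    moreover have "lin_ext free_scale (\<lambda>p. lin_ext free_scale (T p) (s - t)) t \<in> null3 scale"
      by (rule ext_mem, rule right, rule st)
    ultimately have "lin_ext free_scale (\<lambda>p. lin_ext free_scale (T p) s) (s - t)
      + lin_ext free_scale (\<lambda>p. lin_ext free_scale (T p) (s - t)) t \<in> null3 scale"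
      by (rule free.subspace_add[OF subspace_null3])
    moreover have "lin_ext free_scale (\<lambda>p. lin_ext free_scale (T p) (s - t)) t
      = lin_ext free_scale (\<lambda>p. lin_ext free_scale (T p) s) t - cybe_rep mult t"
      unfolding swap cybe_rep_T by (rule free.lin_ext_diff)
    moreover have "lin_ext free_scale (\<lambda>p. lin_ext free_scale (T p) s) (s - t)
      = cybe_rep mult s - lin_ext free_scale (\<lambda>p. lin_ext free_scale (T p) s) t"
      unfolding cybe_rep_T by (rule free.lin_ext_diff)
    ultimately show ?thesis by simp
  qed
  have "cybe scale mult (coset (null2 scale) t) = coset (null3 scale) (cybe_rep mult t)" for t
    unfolding cybe_def
    by (rule coset_map_coset[OF free.module_axioms subspace_null3
          free.subspace_0[OF subspace_null2] well_def])
  moreover have "cybe_rep mult (\<Sum>i\<in>I. basis (x i, y i))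
    = (\<Sum>i\<in>I. \<Sum>j\<in>I. T (x i, y i) (x j, y j) :: _ \<Rightarrow>\<^sub>0 'k)"
    unfolding cybe_rep_T by (simp only: free.lin_ext_sum free.lin_ext_basis)
  ultimately show ?thesis by (simp add: T_def)
qed

end

end

(* In characteristic not 2 the Malcev identity is equivalent to Sagle's identity
     (xz)(yt) = ((xy)z)t + ((yz)t)x + ((zt)x)y + ((tx)y)z,
   which is multilinear and, evaluated against a functional, passes from M to the coadjoint
   extension M + M* with product (a, f)(b, g) = (ab, f.b - g.a), where (f.b)(w) = f(bw).
   A skew-symmetric r = sum u_i (x) v_i induces S : M* -> M, S f = sum f(v_i) u_i. The product of the
   dual algebra is f.(S g) - g.(S f), and the Yang-Baxter equation, contracted with f and g in its
   first two factors, says that S is a homomorphism. Hence (a, f) |-> (a + S f, f) is an isomorphism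
   from the Drinfeld double onto the coadjoint extension. *)

theory Submission
  imports Defs
begin

section \<open>Malcev algebras and Sagle's identity\<close>

text \<open>The difference of the two sides of Sagle's identity. Keeping it as an element lets its
  symmetries be stated before it is known to vanish.\<close>

definition sagle_defect :: "('v \<Rightarrow> 'v \<Rightarrow> 'v) \<Rightarrow> 'v \<Rightarrow> 'v \<Rightarrow> 'v \<Rightarrow> 'v \<Rightarrow> 'v::ab_group_add"
  where "sagle_defect mult x y z t = mult (mult x z) (mult y t)
    - mult (mult (mult x y) z) t - mult (mult (mult y z) t) x
    - mult (mult (mult z t) x) y - mult (mult (mult t x) y) z"

context nonassoc_algebra
begin

lemma add_closed: "x \<in> A \<Longrightarrow> y \<in> A \<Longrightarrow> x + y \<in> A"
  by (rule subspace_add[OF subspace_carrier])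

lemma mult_minus_left: "x \<in> A \<Longrightarrow> y \<in> A \<Longrightarrow> mult (- x) y = - mult x y"
  using mult_scale_left[of x y "- 1"] by simp

lemma mult_diff_left:
  "x \<in> A \<Longrightarrow> y \<in> A \<Longrightarrow> z \<in> A \<Longrightarrow> mult (x - y) z = mult x z - mult y z"
  using mult_add_left[of x "- y" z] subspace_neg[OF subspace_carrier] by (simp add: mult_minus_left)

lemma mult_minus_right: "x \<in> A \<Longrightarrow> y \<in> A \<Longrightarrow> mult x (- y) = - mult x y"
  using mult_scale_right[of x y "- 1"] by simp

end

text \<open>Vanishing squares discard the term ((xx)y)z when the Malcev identity is compared with
  Sagle's; for a Malcev algebra they come from xx = -xx by dividing by 2.\<close>

locale alternating_algebra = nonassoc_algebra +
  assumes alternating: "x \<in> A \<Longrightarrow> mult x x = 0"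
begin

lemma anticommutative:
  assumes "x \<in> A" "y \<in> A"
  shows "mult x y = - mult y x"
proof -
  have "0 = mult (x + y) (x + y)"
    using assms by (simp only: alternating add_closed)
  also have "\<dots> = mult x x + mult x y + (mult y x + mult y y)"
    using assms by (simp add: mult_add_left mult_add_right add_closed)
  also have "\<dots> = mult x y + mult y x"
    using assms by (simp add: alternating)
  finally show ?thesis by (simp only: eq_neg_iff_add_eq_0)
qed

text \<open>Rotating the arguments permutes the four iterated products among themselves, while the
  product of two products changes sign twice.\<close>

lemma sagle_defect_cyclic:
  assumes "x \<in> A" "y \<in> A" "z \<in> A" "t \<in> A"
  shows "sagle_defect mult y z t x = sagle_defect mult x y z t"
proof -
  have zx: "mult z x = - mult x z"
    by (rule anticommutative[OF assms(3,1)])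
  have "mult (mult y t) (mult z x) = - mult (mult z x) (mult y t)"
    by (rule anticommutative[OF mult_closed mult_closed]) fact+
  also have "\<dots> = mult (mult x z) (mult y t)"
    by (simp add: zx mult_minus_left mult_closed assms)
  finally have "mult (mult y t) (mult z x) = mult (mult x z) (mult y t)" .
  then show ?thesis by (simp add: sagle_defect_def)
qed

text \<open>In the difference of the two sides, (y(xz))x and ((zx)y)x cancel by anticommutativity.
  What remains is the defect with its first argument repeated, since ((xx)y)z = 0.\<close>

lemma malcev_iff_sagle_defect:
  assumes "x \<in> A" "y \<in> A" "z \<in> A"
  shows "jacobian mult x y (mult x z) = mult (jacobian mult x y z) x
    \<longleftrightarrow> sagle_defect mult x x y z = 0"
proof -
  have "mult 0 y = 0" "mult 0 z = 0"
    using mult_scale_left[of x y 0] mult_scale_left[of x z 0] assms by simp_all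
  then have 0: "mult (mult (mult x x) y) z = 0"
    using assms by (simp add: alternating)
  have zx: "mult z x = - mult x z"
    by (rule anticommutative[OF assms(3,1)])
  have yxz: "mult y (mult x z) = - mult (mult x z) y"
    by (rule anticommutative[OF _ mult_closed]) fact+
  have "jacobian mult x y (mult x z) - mult (jacobian mult x y z) x = sagle_defect mult x x y z"
    using assms
    by (simp add: jacobian_def sagle_defect_def mult_closed mult_add_left mult_diff_left add_closed
        mult_minus_left 0 zx yxz)
  then show ?thesis by (metis eq_iff_diff_eq_0)
qed

text \<open>Polarization in the first two slots: the defect is additive in each argument, so its
  value at (x + t, x + t) reduces to the two mixed terms.\<close>

lemma sagle_defect_swap:
  assumes "\<And>x. x \<in> A \<Longrightarrow> sagle_defect mult x x y z = 0"
    and "x \<in> A" "t \<in> A" "y \<in> A" "z \<in> A"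
  shows "sagle_defect mult t x y z = - sagle_defect mult x t y z"
proof -
  have "sagle_defect mult (x + t) (x + t) y z = sagle_defect mult x x y z + sagle_defect mult t t y z
    + (sagle_defect mult x t y z + sagle_defect mult t x y z)"
    using assms(2-5)
    by (simp add: sagle_defect_def mult_closed mult_add_left mult_add_right add_closed)
  then show ?thesis
    using assms by (simp add: add_closed eq_neg_iff_add_eq_0 add.commute)
qed

end

section \<open>Sagle's identity in characteristic not 2\<close>

lemma vector_space_double_eq_0:
  fixes scale :: "'k::field \<Rightarrow> 'v::ab_group_add \<Rightarrow> 'v" and v :: 'v
  assumes "vector_space scale" "CHAR('k) \<noteq> 2" "v + v = 0"
  shows "v = 0"
proof -
  interpret vector_space scale by fact
  \<comment> \<open>If 2 were 0, the characteristic would divide 2, hence be 1 or 2; a field does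
    not have characteristic 1.\<close>
  have "(2::'k) \<noteq> 0"
  proof
    assume "(2::'k) = 0"
    then have "of_nat 2 = (0::'k)" by simp
    then have "CHAR('k) dvd 2" by (simp only: of_nat_eq_0_iff_char_dvd)
    then have "CHAR('k) \<le> 2" "CHAR('k) \<noteq> 0" by (auto dest: dvd_imp_le intro!: gr0I)
    moreover have "CHAR('k) \<noteq> 1" using CHAR_not_1[where 'a = 'k] by simp
    ultimately show False using assms(2) by linarith
  qed
  moreover have "scale 2 v = 0"
    by (simp only: one_add_one[symmetric] scale_left_distrib scale_one assms(3))
  ultimately show ?thesis by simp
qed

lemma malcev_algebra_alternating:
  fixes scale :: "'k::field \<Rightarrow> 'v::ab_group_add \<Rightarrow> 'v"
  assumes "malcev_algebra scale A mult" "CHAR('k) \<noteq> 2" "x \<in> A"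
  shows "mult x x = 0"
proof -
  interpret malcev_algebra scale A mult by fact
  have "mult x x + mult x x = 0"
    using anticommutative[OF assms(3,3)] by (simp only: eq_neg_iff_add_eq_0)
  then show ?thesis
    by (rule vector_space_double_eq_0[OF vector_space_axioms assms(2)])
qed

text \<open>The defect is invariant under the 4-cycle of its arguments, an odd permutation, and
  antisymmetric.\<close>

lemma malcev_algebra_sagle:
  fixes scale :: "'k::field \<Rightarrow> 'v::ab_group_add \<Rightarrow> 'v"
  assumes "malcev_algebra scale A mult" "CHAR('k) \<noteq> 2"
    and "x \<in> A" "y \<in> A" "z \<in> A" "t \<in> A"
  shows "sagle_defect mult x y z t = 0"
proof -
  interpret malcev_algebra scale A mult by fact
  interpret alternating_algebra scale A mult
    by unfold_locales (rule malcev_algebra_alternating[OF assms(1,2)])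
  have swap: "sagle_defect mult t x y z = - sagle_defect mult x t y z"
    if "x \<in> A" "y \<in> A" "z \<in> A" "t \<in> A" for x y z t
    using malcev malcev_iff_sagle_defect that by (intro sagle_defect_swap) blast+
  \<comment> \<open>Three exchanges of the first two arguments alternate with three rotations and
    restore the original order; each exchange contributes a sign.\<close>
  have "sagle_defect mult x y z t = - sagle_defect mult y x z t"
    using swap[of y z t x] assms by simp
  also have "\<dots> = - sagle_defect mult x z t y"
    by (simp add: sagle_defect_cyclic[of y x z t] assms)
  also have "\<dots> = sagle_defect mult z x t y"
    using swap[of z t y x] assms by simp
  also have "\<dots> = sagle_defect mult x t y z"
    by (simp add: sagle_defect_cyclic[of z x t y] assms)
  also have "\<dots> = - sagle_defect mult t x y z"
    using swap[of t y z x] assms by simp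
  also have "\<dots> = - sagle_defect mult x y z t"
    by (simp add: sagle_defect_cyclic[of t x y z] assms)
  finally have "sagle_defect mult x y z t + sagle_defect mult x y z t = 0"
    by (simp only: eq_neg_iff_add_eq_0)
  then show ?thesis
    by (rule vector_space_double_eq_0[OF vector_space_axioms assms(2)])
qed

lemma (in alternating_algebra) malcev_algebraI:
  assumes "\<And>x y z t. x \<in> A \<Longrightarrow> y \<in> A \<Longrightarrow> z \<in> A \<Longrightarrow> t \<in> A \<Longrightarrow> sagle_defect mult x y z t = 0"
  shows "malcev_algebra scale A mult"
  using assms by unfold_locales (auto simp: malcev_iff_sagle_defect intro: anticommutative)

text \<open>Every axiom is an equation between products and linear combinations. Its image under
  \<open>\<phi>\<close> is the same axiom in the target, and injectivity on \<open>A\<close>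
  reflects it back.\<close>

lemma malcev_algebra_transport:
  assumes "malcev_algebra scale' B mult'"
    and "vector_space scale" "module.subspace scale A"
    and closed: "\<And>x y. x \<in> A \<Longrightarrow> y \<in> A \<Longrightarrow> mult x y \<in> A"
    and into: "\<And>x. x \<in> A \<Longrightarrow> \<phi> x \<in> B" and inj: "inj_on \<phi> A"
    and add: "\<And>x y. x \<in> A \<Longrightarrow> y \<in> A \<Longrightarrow> \<phi> (x + y) = \<phi> x + \<phi> y"
    and scl: "\<And>c x. x \<in> A \<Longrightarrow> \<phi> (scale c x) = scale' c (\<phi> x)"
    and hom: "\<And>x y. x \<in> A \<Longrightarrow> y \<in> A \<Longrightarrow> \<phi> (mult x y) = mult' (\<phi> x) (\<phi> y)"
  shows "malcev_algebra scale A mult"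
proof -
  interpret B: malcev_algebra scale' B mult' by fact
  interpret vector_space scale by fact
  note sub = subspace_add[OF assms(3)] subspace_scale[OF assms(3)]
  have neg: "- x \<in> A" "\<phi> (- x) = - \<phi> x" if "x \<in> A" for x
    using sub(2)[OF that, of "- 1"] scl[OF that, of "- 1"] by simp_all
  note [simp] = sub neg closed into add scl hom
  have eqI: "x = y" if "\<phi> x = \<phi> y" "x \<in> A" "y \<in> A" for x y
    using inj that by (rule inj_onD)
  show ?thesis
  proof
    show "subspace A" by fact
    show "mult x y = - mult y x" if "x \<in> A" "y \<in> A" for x y
      using that B.anticommutative[of "\<phi> x" "\<phi> y"] by (intro eqI) simp_all
    show "jacobian mult x y (mult x z) = mult (jacobian mult x y z) x"
      if "x \<in> A" "y \<in> A" "z \<in> A" for x y z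
      using that B.malcev[of "\<phi> x" "\<phi> y" "\<phi> z"]
      by (intro eqI) (simp_all add: jacobian_def)
  qed (auto intro!: eqI simp: B.mult_add_left B.mult_add_right B.mult_scale_left B.mult_scale_right)
qed


section \<open>The coadjoint extension\<close>

text \<open>The semidirect product of M with M* under the coadjoint action. For an anticommutative
  product, it is the double that belongs to the zero comultiplication, because the left coaction on
  a functional is the negative of the right one.\<close>

definition coadjoint_mult ::
  "('m \<Rightarrow> 'm \<Rightarrow> 'm) \<Rightarrow> 'm \<times> ('m \<Rightarrow> 'k) \<Rightarrow> 'm \<times> ('m \<Rightarrow> 'k) \<Rightarrow> 'm \<times> ('m \<Rightarrow> 'k::ab_group_add)"
  where "coadjoint_mult mult = (\<lambda>(a, f) (b, g).
    (mult a b, coact_right mult f b - coact_right mult g a))"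

context vector_space
begin

lemma dual_iff:
  "f \<in> dual scale \<longleftrightarrow> (\<forall>x y. f (x + y) = f x + f y) \<and> (\<forall>c x. f (c *s x) = c * f x)"
proof
  assume "f \<in> dual scale"
  then interpret f: Vector_Spaces.linear scale "(*)" f by (simp add: dual_def)
  show "(\<forall>x y. f (x + y) = f x + f y) \<and> (\<forall>c x. f (c *s x) = c * f x)"
    by (simp add: f.add f.scale)
next
  assume *: "(\<forall>x y. f (x + y) = f x + f y) \<and> (\<forall>c x. f (c *s x) = c * f x)"
  interpret K: vector_space "(*) :: 'a \<Rightarrow> 'a \<Rightarrow> 'a" by (rule vector_space_field)
  have "Vector_Spaces.linear scale (*) f" by unfold_locales (simp_all add: *)
  then show "f \<in> dual scale" by (simp add: dual_def)
qed

lemma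
  assumes "f \<in> dual scale"
  shows dual_add: "f (x + y) = f x + f y"
    and dual_scale: "f (c *s x) = c * f x"
    and dual_0: "f 0 = 0"
    and dual_minus: "f (- x) = - f x"
    and dual_diff: "f (x - y) = f x - f y"
    and dual_sum: "f (\<Sum>i\<in>I. h i) = (\<Sum>i\<in>I. f (h i))"
proof -
  interpret f: Vector_Spaces.linear scale "(*)" f using assms by (simp add: dual_def)
  show "f (x + y) = f x + f y" "f (c *s x) = c * f x" "f 0 = 0" "f (- x) = - f x"
    "f (x - y) = f x - f y" "f (\<Sum>i\<in>I. h i) = (\<Sum>i\<in>I. f (h i))"
    by (simp_all add: f.add f.scale f.neg f.diff f.sum)
qed

lemma vector_space_double_scale: "vector_space (double_scale scale)"
  by unfold_locales
    (auto simp: double_scale_def fun_eq_iff scale_right_distrib scale_left_distrib algebra_simps)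

lemma subspace_double_carrier: "module.subspace (double_scale scale) (double_carrier scale)"
proof -
  interpret D: vector_space "double_scale scale" by (rule vector_space_double_scale)
  show ?thesis
    by (auto simp: D.subspace_def double_carrier_def double_scale_def dual_iff zero_prod_def
        algebra_simps)
qed

end

context nonassoc_algebra
begin

lemma coact_right_dual:
  assumes "A = UNIV" "f \<in> dual scale"
  shows "coact_right mult f a \<in> dual scale"
  using assms(1)
  by (simp add: dual_iff coact_right_def mult_add_right mult_scale_right
      dual_add[OF assms(2)] dual_scale[OF assms(2)])

end

text \<open>Products of two functionals vanish, so each term in the second component of the defect
  involves exactly one of the four functionals. Evaluated at a vector w, the terms of each
  functional add up to its value at a defect in M, which is 0.\<close>

lemma malcev_algebra_coadjoint:
  fixes scale :: "'k::field \<Rightarrow> 'm::ab_group_add \<Rightarrow> 'm"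
  assumes "malcev_algebra scale UNIV mult" "CHAR('k) \<noteq> 2"
  shows "malcev_algebra (double_scale scale) (double_carrier scale) (coadjoint_mult mult)"
proof -
  interpret malcev_algebra scale UNIV mult by fact
  interpret D: vector_space "double_scale scale" by (rule vector_space_double_scale)
  note coact = coact_right_dual[OF refl]
  have sub: "f - g \<in> dual scale" if "f \<in> dual scale" "g \<in> dual scale" for f g
    using that by (simp add: dual_iff algebra_simps)
  have alt: "mult x x = 0" for x
    by (rule malcev_algebra_alternating[OF assms UNIV_I])
  interpret D: alternating_algebra "double_scale scale" "double_carrier scale"
    "coadjoint_mult mult"
    by (intro alternating_algebra.intro nonassoc_algebra.intro nonassoc_algebra_axioms.intro
          alternating_algebra_axioms.intro D.vector_space_axioms subspace_double_carrier)
      (auto simp: coadjoint_mult_def double_carrier_def double_scale_def coact sub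
        coact[unfolded coact_right_def]
        coact_right_def fun_eq_iff mult_add_left mult_add_right mult_scale_left mult_scale_right
        dual_add dual_scale alt algebra_simps zero_prod_def)
  note anticomm = anticommutative[OF UNIV_I UNIV_I]
  note minus = mult_minus_left[OF UNIV_I UNIV_I] mult_minus_right[OF UNIV_I UNIV_I]
  note sagle = malcev_algebra_sagle[OF assms UNIV_I UNIV_I UNIV_I UNIV_I]
  show ?thesis
  proof (rule D.malcev_algebraI)
    fix x y z t
    assume *: "x \<in> double_carrier scale" "y \<in> double_carrier scale"
      "z \<in> double_carrier scale" "t \<in> double_carrier scale"
    obtain a f where x: "x = (a, f)" by (cases x)
    obtain b g where y: "y = (b, g)" by (cases y)
    obtain c h where z: "z = (c, h)" by (cases z)
    obtain d k where t: "t = (d, k)" by (cases t)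
    note xyzt = x y z t
    have dual: "f \<in> dual scale" "g \<in> dual scale" "h \<in> dual scale" "k \<in> dual scale"
      using * by (auto simp: xyzt double_carrier_def)
    \<comment> \<open>This is the contribution of the functional in the fourth slot, evaluated at w.
      Anticommutativity turns the argument of \<open>k\<close> into the defect at (b, a, c,
      w).\<close>
    have coad: "k (mult b (mult (mult a c) w)) + k (mult (mult (mult a b) c) w)
        + k (mult (mult b c) (mult a w)) + k (mult c (mult a (mult b w)))
        - k (mult a (mult b (mult c w))) = 0" if k: "k \<in> dual scale" for k a b c w
    proof -
      have "mult (mult b a) c = - mult (mult a b) c" "mult (mult w b) a = mult a (mult b w)"
        using anticomm[of b a] anticomm[of w b] anticomm[of "mult b w" a]
        by (simp_all add: minus)
      then have "mult b (mult (mult a c) w) + mult (mult (mult a b) c) w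
          + mult (mult b c) (mult a w) + mult c (mult a (mult b w)) - mult a (mult b (mult c w))
        = sagle_defect mult b a c w"
        unfolding sagle_defect_def
        using anticomm[of "mult (mult a c) w" b] anticomm[of "mult a (mult b w)" c]
          anticomm[of "mult c w" b] anticomm[of "mult b (mult c w)" a]
        by (simp add: minus)
      then have "k (mult b (mult (mult a c) w) + mult (mult (mult a b) c) w
          + mult (mult b c) (mult a w) + mult c (mult a (mult b w)) - mult a (mult b (mult c w))) = 0"
        by (simp only: sagle dual_0[OF k])
      then show ?thesis by (simp only: dual_add[OF k] dual_diff[OF k])
    qed
    \<comment> \<open>The contributions of \<open>f\<close>, \<open>g\<close> and \<open>h\<close>
      have the shape of that of \<open>k\<close> with the arguments rotated, in accordance with the
      cyclic symmetry of the defect.\<close>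
    have snd0: "snd (sagle_defect (coadjoint_mult mult) x y z t) w = 0" for w
    proof -
      have "snd (sagle_defect (coadjoint_mult mult) x y z t) w
        = (f (mult c (mult (mult b d) w)) + f (mult (mult (mult b c) d) w)
            + f (mult (mult c d) (mult b w)) + f (mult d (mult b (mult c w)))
            - f (mult b (mult c (mult d w))))
          + (g (mult d (mult (mult c a) w)) + g (mult (mult (mult c d) a) w)
            + g (mult (mult d a) (mult c w)) + g (mult a (mult c (mult d w)))
            - g (mult c (mult d (mult a w))))
          + (h (mult a (mult (mult d b) w)) + h (mult (mult (mult d a) b) w)
            + h (mult (mult a b) (mult d w)) + h (mult b (mult d (mult a w)))
            - h (mult d (mult a (mult b w))))
          + (k (mult b (mult (mult a c) w)) + k (mult (mult (mult a b) c) w)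
            + k (mult (mult b c) (mult a w)) + k (mult c (mult a (mult b w)))
            - k (mult a (mult b (mult c w))))"
        using anticomm[of c a] anticomm[of d b] dual
        by (simp add: xyzt sagle_defect_def coadjoint_mult_def coact_right_def minus dual_minus)
      also have "\<dots> = 0"
        by (simp only: coad dual add_0)
      finally show ?thesis .
    qed
    have "fst (sagle_defect (coadjoint_mult mult) x y z t) = 0"
      using sagle[of a b c d] by (simp add: xyzt sagle_defect_def coadjoint_mult_def)
    with snd0 show "sagle_defect (coadjoint_mult mult) x y z t = 0"
      by (simp add: prod_eq_iff fun_eq_iff)
  qed
qed

section \<open>The double of a skew-symmetric solution\<close>

lemma coset_eq_0_iff:
  assumes "module.subspace scale W" "module scale"
  shows "coset W t = coset W 0 \<longleftrightarrow> t \<in> W"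
proof -
  interpret module scale by fact
  have "t \<in> coset W t" using subspace_0[OF assms(1)] by (simp add: mem_coset_iff)
  then show ?thesis using coset_cong[OF assms, of t 0] mem_coset_iff[of t W 0] by auto
qed

lemma
  assumes "module.subspace scale W" "module scale"
  shows coset_add_coset: "coset_add W (coset W s) (coset W t) = coset W (s + t)"
    and coset_diff_coset: "coset_diff W (coset W s) (coset W t) = coset W (s - t)"
proof -
  interpret module scale by fact
  have mem: "s \<in> coset W s" for s using subspace_0[OF assms(1)] by (simp add: mem_coset_iff)
  have "coset W (s' + t') = coset W (s + t)" "coset W (s' - t') = coset W (s - t)"
    if "s' \<in> coset W s" "t' \<in> coset W t" for s' t'
  proof -
    have "s' + t' - (s + t) = (s' - s) + (t' - t)" "s' - t' - (s - t) = (s' - s) - (t' - t)"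
      by simp_all
    then show "coset W (s' + t') = coset W (s + t)" "coset W (s' - t') = coset W (s - t)"
      using that subspace_add[OF assms(1)] subspace_diff[OF assms(1)]
      by (auto simp only: mem_coset_iff intro!: coset_cong[OF assms])
  qed
  note eq = this
  have ne: "coset W s \<noteq> {}" "coset W t \<noteq> {}"
    using mem by blast+
  show "coset_add W (coset W s) (coset W t) = coset W (s + t)"
    "coset_diff W (coset W s) (coset W t) = coset W (s - t)"
    unfolding coset_add_def coset_diff_def by (simp_all add: eq ne cong: SUP_cong_simp)
qed

text \<open>The formulas for contractions expect a plain sum of pure tensors. Differences are
  brought to that form by doubling the index set and moving the sign into the first factor.\<close>

lemma (in vector_space) coset_sum_diff:
  assumes "finite I"
  shows "coset (null2 scale) (\<Sum>i\<in>I. basis (x i, y i) - basis (x' i, y' i))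
    = coset (null2 scale)
        (\<Sum>j\<in>I <+> I. basis (case_sum x (\<lambda>i. - x' i) j, case_sum y y' j))"
proof (rule coset_cong[OF subspace_null2 free.module_axioms])
  have "- (basis (x' i, y' i) + basis (- x' i, y' i)) \<in> null2 scale" for i
    using free.subspace_neg[OF subspace_null2 null2_scale_left[of scale "- 1" "x' i" "y' i"]]
    by (simp add: free.scale_minus_left add.commute del: free_scale_single)
  then have "(\<Sum>i\<in>I. - (basis (x' i, y' i) + basis (- x' i, y' i))) \<in> null2 scale"
    by (intro free.subspace_sum subspace_null2)
  then show "(\<Sum>i\<in>I. basis (x i, y i) - basis (x' i, y' i))
      - (\<Sum>j\<in>I <+> I. basis (case_sum x (\<lambda>i. - x' i) j, case_sum y y' j)) \<in> null2 scale"
    using assms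
    by (simp add: sum.Plus sum_subtractf sum.distrib sum_negf)
qed

text \<open>For a fixed presentation of \<open>r\<close>, each summand is linear in \<open>a\<close>
  modulo the bilinearity relations: in its first term through the left factor, in its second through
  the right one.\<close>

lemma linear_comult_comult_of:
  fixes scale :: "'k::field \<Rightarrow> 'm::ab_group_add \<Rightarrow> 'm"
  assumes "nonassoc_algebra scale UNIV mult" "r \<in> tensor2 scale"
  shows "linear_comult scale (comult_of scale mult r)"
proof -
  interpret nonassoc_algebra scale UNIV mult by fact
  note mod = subspace_null2 free.module_axioms
  obtain I and x y :: "'m \<times> 'm \<Rightarrow> 'm"
    where r: "r = coset (null2 scale) (\<Sum>i\<in>I. basis (x i, y i))"
    by (rule tensor2_presentation[OF assms(2)])
  define t where "t i a = basis (mult (x i) a, y i) - (basis (x i, mult a (y i)) :: _ \<Rightarrow>\<^sub>0 'k)"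
    for i a
  have \<Delta>: "comult_of scale mult r a = coset (null2 scale) (\<Sum>i\<in>I. t i a)" for a
    unfolding r t_def by (rule comult_of_presentation[OF assms(1)])
  have add: "t i (a + b) - (t i a + t i b) \<in> null2 scale" for i a b
    using free.subspace_diff[OF subspace_null2
        null2_add_left[of "mult (x i) a" "mult (x i) b" "y i"]
        null2_add_right[of "x i" "mult a (y i)" "mult b (y i)"]]
    by (simp add: t_def mult_add_left mult_add_right algebra_simps)
  have scl: "t i (scale c a) - free_scale c (t i a) \<in> null2 scale" for i c a
    using free.subspace_diff[OF subspace_null2
        null2_scale_left[of scale c "mult (x i) a" "y i"]
        null2_scale_right[of "x i" scale c "mult a (y i)"]]
    by (simp add: t_def mult_scale_left mult_scale_right free.scale_right_diff_distrib
        algebra_simps)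
  show ?thesis
    unfolding linear_comult_def
  proof (intro conjI allI)
    fix a b c
    show "comult_of scale mult r a \<in> tensor2 scale"
      by (simp add: \<Delta> tensor2_def quotient_space_def)
    have "(\<Sum>i\<in>I. t i (a + b)) - ((\<Sum>i\<in>I. t i a) + (\<Sum>i\<in>I. t i b)) \<in> null2 scale"
      unfolding sum.distrib[symmetric] sum_subtractf[symmetric]
      by (intro free.subspace_sum subspace_null2 add)
    then show "comult_of scale mult r (a + b)
      = coset_add (null2 scale) (comult_of scale mult r a) (comult_of scale mult r b)"
      unfolding \<Delta> coset_add_coset[OF mod] by (rule coset_cong[OF mod])
    have *: "coset_map (null2 scale) (free_scale c) (coset (null2 scale) s)
      = coset (null2 scale) (free_scale c s)" for s
      by (rule coset_map_coset[OF free.module_axioms subspace_null2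
            free.subspace_0[OF subspace_null2]])
        (simp only: free.scale_right_diff_distrib[symmetric] free.subspace_scale[OF subspace_null2])
    have "(\<Sum>i\<in>I. t i (scale c a)) - free_scale c (\<Sum>i\<in>I. t i a) \<in> null2 scale"
      unfolding free.scale_sum_right sum_subtractf[symmetric]
      by (intro free.subspace_sum subspace_null2 scl)
    then show "comult_of scale mult r (scale c a)
      = coset_map (null2 scale) (free_scale c) (comult_of scale mult r a)"
      unfolding \<Delta> * by (rule coset_cong[OF mod])
  qed
qed

text \<open>The map sending p, q, s to f(p) g(q) s is trilinear, so it kills the relations. This
  lets the Yang-Baxter equation be contracted in its first two factors.\<close>

lemma (in vector_space) lin_ext_null3_contract:
  assumes f: "f \<in> dual scale" and g: "g \<in> dual scale" and "w \<in> null3 scale"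
  shows "lin_ext scale (\<lambda>(p, q, s). (f p * g q) *s s) w = 0"
proof -
  let ?F = "\<lambda>(p, q, s). (f p * g q) *s s"
  have "free.subspace {w. lin_ext scale ?F w = 0}"
    by (auto simp: free.subspace_def lin_ext_0 lin_ext_add lin_ext_scale)
  then have "null3 scale \<subseteq> {w. lin_ext scale ?F w = 0}"
    unfolding null3_def
    by (intro free.span_minimal)
      (auto simp: lin_ext_diff lin_ext_scale dual_add[OF f] dual_add[OF g] dual_scale[OF f]
        dual_scale[OF g] scale_left_distrib scale_right_distrib distrib_left distrib_right
        mult.assoc mult.left_commute mult.commute simp del: free_scale_single)
  then show ?thesis using assms(3) by blast
qed

text \<open>Skewness is required in the form in which it is used: contracting the first factor gives
  the negative of contracting the second.\<close>

locale skew_tensor = nonassoc_algebra scale UNIV mult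
  for scale :: "'k::field \<Rightarrow> 'm::ab_group_add \<Rightarrow> 'm" and mult :: "'m \<Rightarrow> 'm \<Rightarrow> 'm" +
  fixes I :: "'i set" and u v :: "'i \<Rightarrow> 'm"
  assumes anticomm: "mult x y = - mult y x"
    and finite: "finite I"
    and skew: "f \<in> dual scale \<Longrightarrow> (\<Sum>i\<in>I. scale (f (u i)) (v i)) = - (\<Sum>i\<in>I. scale (f (v i)) (u i))"
begin

section \<open>The operations of the double in terms of the induced map M* -> M\<close>

definition tensor :: "('m, 'k) tensor2"
  where "tensor = coset (null2 scale) (\<Sum>i\<in>I. basis (u i, v i))"

text \<open>The map S : M* -> M obtained by contracting the second factor of the tensor.\<close>

definition sharp :: "('m \<Rightarrow> 'k) \<Rightarrow> 'm"
  where "sharp f = (\<Sum>i\<in>I. scale (f (v i)) (u i))"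

lemma sharp_skew: "f \<in> dual scale \<Longrightarrow> (\<Sum>i\<in>I. scale (f (u i)) (v i)) = - sharp f"
  unfolding sharp_def by (rule skew)

lemma sharp_add: "sharp (f + g) = sharp f + sharp g"
  by (simp add: sharp_def scale_left_distrib sum.distrib)

lemma sharp_diff: "sharp (f - g) = sharp f - sharp g"
  by (simp add: sharp_def scale_left_diff_distrib sum_subtractf)

lemma sharp_scale: "sharp (\<lambda>x. c * f x) = scale c (sharp f)"
  by (simp add: sharp_def scale_sum_right)

lemma mult_sum_left: "mult (\<Sum>i\<in>J. scale (c i) (w i)) a = (\<Sum>i\<in>J. scale (c i) (mult (w i) a))"
  \<comment> \<open>The scalar 0 gives 0 a = 0, needed for empty and infinite index sets.\<close>
  using mult_scale_left[of 0 a 0]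
  by (induction J rule: infinite_finite_induct) (simp_all add: mult_add_left mult_scale_left)

lemma mult_sum_right: "mult a (\<Sum>i\<in>J. scale (c i) (w i)) = (\<Sum>i\<in>J. scale (c i) (mult a (w i)))"
  using mult_scale_right[of a 0 0]
  by (induction J rule: infinite_finite_induct) (simp_all add: mult_add_right mult_scale_right)

lemma minus_mult: "mult (- x) y = - mult x y" "mult x (- y) = - mult x y"
  by (simp_all add: mult_minus_left mult_minus_right)

lemma coact_right_neg: "f \<in> dual scale \<Longrightarrow> f (mult x a) = - coact_right mult f a x"
  by (simp add: coact_right_def anticomm[of x a] dual_minus)

lemma comult_tensor:
  "comult_of scale mult tensor a = coset (null2 scale)
    (\<Sum>j\<in>I <+> I. basis (case_sum (\<lambda>i. mult (u i) a) (\<lambda>i. - u i) j,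
      case_sum v (\<lambda>i. mult a (v i)) j))"
  unfolding tensor_def comult_of_presentation[OF nonassoc_algebra_axioms]
  by (rule coset_sum_diff[OF finite])

text \<open>Both parts of the comultiplication are contracted in the second factor: f(v_i) (u_i a)
  sums to (S f) a, and f(a v_i) u_i sums to S(f.a).\<close>

lemma contract_right_tensor:
  assumes f: "f \<in> dual scale"
  shows "contract_right scale (comult_of scale mult tensor) f a
    = mult (sharp f) a - sharp (coact_right mult f a)"
  unfolding contract_right_presentation[OF f comult_tensor]
  by (simp add: sum.Plus finite sharp_def mult_sum_left coact_right_def sum_negf)

lemma contract_left_tensor:
  assumes f: "f \<in> dual scale"
  shows "contract_left scale (comult_of scale mult tensor) a f
    = mult a (sharp f) + sharp (coact_right mult f a)"
proof -
  \<comment> \<open>Here the first factor is contracted, and f(u_i a) = -(f.a)(u_i). Skewness then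
    reverses the sign of both sums.\<close>
  have "contract_left scale (comult_of scale mult tensor) a f
    = - (\<Sum>i\<in>I. scale (coact_right mult f a (u i)) (v i)) - mult a (\<Sum>i\<in>I. scale (f (u i)) (v i))"
    unfolding contract_left_presentation[OF f comult_tensor]
    by (simp add: sum.Plus finite mult_sum_right sum_negf coact_right_neg[OF f] dual_minus[OF f])
  then show ?thesis
    by (simp add: sharp_skew f coact_right_dual minus_mult)
qed

lemma dual_mult_tensor:
  assumes f: "f \<in> dual scale" and g: "g \<in> dual scale"
  shows "dual_mult (comult_of scale mult tensor) f g
    = coact_right mult f (sharp g) - coact_right mult g (sharp f)"
proof
  fix a
  have "dual_mult (comult_of scale mult tensor) f g a
    = f (mult (sharp g) a) - g (mult a (\<Sum>i\<in>I. scale (f (u i)) (v i)))"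
    unfolding dual_mult_presentation[OF f g comult_tensor]
    by (simp add: sum.Plus finite sharp_def mult_sum_left mult_sum_right sum_negf
        dual_minus[OF f] dual_sum[OF f] dual_sum[OF g] dual_scale[OF f] dual_scale[OF g]
        mult.commute)
  \<comment> \<open>The sign from skewness is absorbed by exchanging the factors.\<close>
  also have "mult a (\<Sum>i\<in>I. scale (f (u i)) (v i)) = mult (sharp f) a"
    by (simp add: sharp_skew f minus_mult anticomm[of "sharp f" a])
  finally show "dual_mult (comult_of scale mult tensor) f g a
    = (coact_right mult f (sharp g) - coact_right mult g (sharp f)) a"
    by (simp add: coact_right_def)
qed

section \<open>The Yang-Baxter equation and the comparison with the coadjoint extension\<close>

lemma coact_left_neg:
  assumes "f \<in> dual scale"
  shows "coact_left mult a f = - coact_right mult f a"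
  by (simp add: fun_eq_iff coact_left_def coact_right_neg[OF assms])

lemma coact_right_add:
  assumes "f \<in> dual scale"
  shows "coact_right mult f (a + b) = coact_right mult f a + coact_right mult f b"
  by (simp add: fun_eq_iff coact_right_def mult_add_left dual_add[OF assms])

text \<open>Contracted with \<open>f\<close> and \<open>g\<close>, the three sums of the Yang-Baxter
  element become -S(f.(S g)), -S(g.(S f)) and (S f)(S g). With their signs -, subtracted, added as
  in the equation, they give the claim.\<close>

lemma sharp_hom_of_cybe:
  assumes cybe: "cybe scale mult tensor = coset (null3 scale) 0"
    and f: "f \<in> dual scale" and g: "g \<in> dual scale"
  shows "mult (sharp f) (sharp g)
    = sharp (coact_right mult f (sharp g) - coact_right mult g (sharp f))"
proof -
  let ?F = "\<lambda>(p, q, s). scale (f p * g q) s"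
  have "(\<Sum>i\<in>I. \<Sum>j\<in>I. basis (mult (u i) (u j), v i, v j) - basis (u i, mult (u j) (v i), v j)
      + basis (u i, u j, mult (v i) (v j))) \<in> null3 scale"
    using cybe
    unfolding tensor_def cybe_presentation[OF nonassoc_algebra_axioms]
      coset_eq_0_iff[OF subspace_null3 free.module_axioms] .
  from lin_ext_null3_contract[OF f g this]
  have 0: "(\<Sum>i\<in>I. \<Sum>j\<in>I. scale (f (mult (u i) (u j)) * g (v i)) (v j))
      - (\<Sum>i\<in>I. \<Sum>j\<in>I. scale (f (u i) * g (mult (u j) (v i))) (v j))
      + (\<Sum>i\<in>I. \<Sum>j\<in>I. scale (f (u i) * g (u j)) (mult (v i) (v j))) = 0"
    by (simp add: lin_ext_sum lin_ext_add lin_ext_diff sum.distrib sum_subtractf)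
  \<comment> \<open>Summing over i first replaces u_i by S g; the sum over j then contracts a first
    factor, whence the sign.\<close>
  have "(\<Sum>i\<in>I. \<Sum>j\<in>I. scale (f (mult (u i) (u j)) * g (v i)) (v j))
    = (\<Sum>j\<in>I. scale (coact_right mult f (sharp g) (u j)) (v j))"
    unfolding sharp_def coact_right_def mult_sum_left dual_sum[OF f] dual_scale[OF f]
      scale_sum_left
    by (subst sum.swap) (simp only: mult.commute)
  also have "\<dots> = - sharp (coact_right mult f (sharp g))"
    by (rule sharp_skew[OF coact_right_dual[OF refl f]])
  finally have 1: "(\<Sum>i\<in>I. \<Sum>j\<in>I. scale (f (mult (u i) (u j)) * g (v i)) (v j))
    = - sharp (coact_right mult f (sharp g))" .
  \<comment> \<open>The inner sum over i is -S f, and moving it to the left of u_j cancels this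
    sign. The remaining minus comes from the sum over j.\<close>
  have "(\<Sum>i\<in>I. \<Sum>j\<in>I. scale (f (u i) * g (mult (u j) (v i))) (v j))
    = (\<Sum>j\<in>I. scale (g (mult (u j) (\<Sum>i\<in>I. scale (f (u i)) (v i)))) (v j))"
    unfolding mult_sum_right dual_sum[OF g] dual_scale[OF g] scale_sum_left
    by (rule sum.swap)
  also have "\<dots> = (\<Sum>j\<in>I. scale (coact_right mult g (sharp f) (u j)) (v j))"
    by (simp add: sharp_skew[OF f] minus_mult dual_minus[OF g] coact_right_neg[OF g])
  also have "\<dots> = - sharp (coact_right mult g (sharp f))"
    by (rule sharp_skew[OF coact_right_dual[OF refl g]])
  finally have 2: "(\<Sum>i\<in>I. \<Sum>j\<in>I. scale (f (u i) * g (mult (u j) (v i))) (v j))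
    = - sharp (coact_right mult g (sharp f))" .
  \<comment> \<open>Both first factors are contracted, so the two signs from skewness
    cancel.\<close>
  have "(\<Sum>i\<in>I. \<Sum>j\<in>I. scale (f (u i) * g (u j)) (mult (v i) (v j)))
    = mult (\<Sum>i\<in>I. scale (f (u i)) (v i)) (\<Sum>j\<in>I. scale (g (u j)) (v j))"
    unfolding mult_sum_left mult_sum_right scale_sum_right scale_scale
    by (subst sum.swap) (simp only: mult.commute)
  also have "\<dots> = mult (sharp f) (sharp g)"
    by (simp add: sharp_skew f g minus_mult)
  finally have 3: "(\<Sum>i\<in>I. \<Sum>j\<in>I. scale (f (u i) * g (u j)) (mult (v i) (v j)))
    = mult (sharp f) (sharp g)" .
  from 0 show ?thesis
    unfolding 1 2 3 sharp_diff by (simp add: algebra_simps eq_neg_iff_add_eq_0)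
qed

definition untwist :: "'m \<times> ('m \<Rightarrow> 'k) \<Rightarrow> 'm \<times> ('m \<Rightarrow> 'k)"
  where "untwist = (\<lambda>(a, f). (a + sharp f, f))"

text \<open>Adding S of the second component cancels S(f.b) and S(g.a) in the first. The
  homomorphism property of S turns the rest into (a + S f)(b + S g), and additivity of the coaction
  gives the second component.\<close>

lemma untwist_hom:
  assumes cybe: "cybe scale mult tensor = coset (null3 scale) 0"
    and "x \<in> double_carrier scale" "y \<in> double_carrier scale"
  shows "untwist (double_mult scale mult (comult_of scale mult tensor) x y)
    = coadjoint_mult mult (untwist x) (untwist y)"
proof -
  obtain a f where x: "x = (a, f)" by (cases x)
  obtain b g where y: "y = (b, g)" by (cases y)
  from x y have f: "f \<in> dual scale" and g: "g \<in> dual scale"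
    using assms(2,3) by (auto simp: double_carrier_def)
  have "double_mult scale mult (comult_of scale mult tensor) x y
    = (mult a b + (mult (sharp f) b - sharp (coact_right mult f b))
        + (mult a (sharp g) + sharp (coact_right mult g a)),
      coact_right mult f (sharp g) - coact_right mult g (sharp f)
        + coact_right mult f b - coact_right mult g a)"
    by (simp add: x y double_mult_def f g contract_right_tensor contract_left_tensor
        dual_mult_tensor coact_left_neg)
  then have "untwist (double_mult scale mult (comult_of scale mult tensor) x y)
    = (mult a b + mult (sharp f) b + mult a (sharp g)
        + sharp (coact_right mult f (sharp g) - coact_right mult g (sharp f)),
      coact_right mult f (sharp g) - coact_right mult g (sharp f)
        + coact_right mult f b - coact_right mult g a)"
    by (simp add: untwist_def sharp_add sharp_diff)
  also have "\<dots> = coadjoint_mult mult (a + sharp f, f) (b + sharp g, g)"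
    unfolding sharp_hom_of_cybe[OF cybe f g, symmetric]
    by (simp add: coadjoint_mult_def mult_add_left mult_add_right coact_right_add[OF f]
        coact_right_add[OF g])
  finally show ?thesis by (simp add: x y untwist_def)
qed

lemma double_mult_closed:
  assumes "x \<in> double_carrier scale" "y \<in> double_carrier scale"
  shows "double_mult scale mult (comult_of scale mult tensor) x y \<in> double_carrier scale"
proof -
  have diff: "f - g \<in> dual scale" and add: "f + g \<in> dual scale"
    if "f \<in> dual scale" "g \<in> dual scale" for f g
    using that by (simp_all add: dual_iff algebra_simps)
  obtain a f where x: "x = (a, f)" by (cases x)
  obtain b g where y: "y = (b, g)" by (cases y)
  from x y assms have f: "f \<in> dual scale" and g: "g \<in> dual scale"
    by (simp_all add: double_carrier_def)
  show ?thesis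
    by (simp add: x y double_mult_def double_carrier_def dual_mult_tensor coact_left_neg
        coact_right_dual diff add f g)
qed

end

text \<open>Contracting x_i \<otimes> y_i - y_i \<otimes> x_i in either factor gives opposite
  vectors, so writing r as s minus its flip supplies the skewness that \<open>skew_tensor\<close>
  asks for.\<close>

lemma skew_presentation:
  fixes scale :: "'k::field \<Rightarrow> 'm::ab_group_add \<Rightarrow> 'm"
  assumes "vector_space scale"
    and "r \<in> (\<lambda>t. coset_diff (null2 scale) t (flip scale t)) ` tensor2 scale"
  obtains I :: "('m \<times> 'm + 'm \<times> 'm) set" and u v
  where "finite I" "r = coset (null2 scale) (\<Sum>i\<in>I. basis (u i, v i))"
    and "\<And>f. f \<in> dual scale \<Longrightarrow>
      (\<Sum>i\<in>I. scale (f (u i)) (v i)) = - (\<Sum>i\<in>I. scale (f (v i)) (u i))"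
proof -
  interpret vector_space scale by fact
  obtain s where s: "s \<in> tensor2 scale" "r = coset_diff (null2 scale) s (flip scale s)"
    using assms(2) by blast
  obtain I and x y :: "'m \<times> 'm \<Rightarrow> 'm"
    where I: "finite I" and s': "s = coset (null2 scale) (\<Sum>i\<in>I. basis (x i, y i))"
    by (rule tensor2_presentation[OF s(1)])
  \<comment> \<open>The left copy of the index set carries x_i \<otimes> y_i, the right copy (-y_i)
    \<otimes> x_i.\<close>
  let ?u = "case_sum x (\<lambda>i. - y i)" and ?v = "case_sum y x"
  have "r = coset (null2 scale) (\<Sum>i\<in>I. basis (x i, y i) - basis (y i, x i))"
    unfolding s(2) s' flip_presentation coset_diff_coset[OF subspace_null2 free.module_axioms]
    by (simp only: sum_subtractf)
  then have "r = coset (null2 scale) (\<Sum>j\<in>I <+> I. basis (?u j, ?v j))"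
    using coset_sum_diff[OF I] by (rule trans)
  moreover have "(\<Sum>j\<in>I <+> I. scale (f (?u j)) (?v j)) = - (\<Sum>j\<in>I <+> I. scale (f (?v j)) (?u j))"
    if "f \<in> dual scale" for f
    using I by (simp add: sum.Plus dual_minus[OF that] sum_negf)
  moreover have "finite (I <+> I)" using I by simp
  ultimately show thesis using that by blast
qed

theorem corollary1:
  fixes scale :: "'k::field \<Rightarrow> 'm::ab_group_add \<Rightarrow> 'm"
    and mult :: "'m \<Rightarrow> 'm \<Rightarrow> 'm"
    and r :: "('m, 'k) tensor2"
  assumes "CHAR('k) \<noteq> 2"
    and "malcev_algebra scale UNIV mult"
    and "r \<in> (\<lambda>t. coset_diff (null2 scale) t (flip scale t)) ` tensor2 scale"
    and "cybe scale mult r = coset (null3 scale) 0"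
  shows "malcev_bialgebra scale mult (comult_of scale mult r)"
proof -
  interpret malcev_algebra scale UNIV mult by fact
  interpret D: vector_space "double_scale scale" by (rule vector_space_double_scale)
  obtain I :: "('m \<times> 'm + 'm \<times> 'm) set" and u v
    where I: "finite I" and r: "r = coset (null2 scale) (\<Sum>i\<in>I. basis (u i, v i))"
      and skew: "\<And>f. f \<in> dual scale \<Longrightarrow>
        (\<Sum>i\<in>I. scale (f (u i)) (v i)) = - (\<Sum>i\<in>I. scale (f (v i)) (u i))"
    by (rule skew_presentation[OF vector_space_axioms assms(3)]) (rule that)
  interpret r: skew_tensor scale mult I u v
    by unfold_locales (fact anticommutative[OF UNIV_I UNIV_I] I skew)+
  have tensor: "r.tensor = r" by (simp add: r r.tensor_def)
  have "malcev_algebra (double_scale scale) (double_carrier scale)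
    (double_mult scale mult (comult_of scale mult r))"
  proof (rule malcev_algebra_transport[OF malcev_algebra_coadjoint[OF assms(2,1)]
        vector_space_double_scale subspace_double_carrier])
    show "r.untwist x \<in> double_carrier scale" if "x \<in> double_carrier scale" for x
      using that by (auto simp: r.untwist_def double_carrier_def)
    show "inj_on r.untwist (double_carrier scale)"
      by (auto simp: inj_on_def r.untwist_def)
    show "r.untwist (x + y) = r.untwist x + r.untwist y" for x y
      by (simp add: r.untwist_def r.sharp_add case_prod_unfold)
    show "r.untwist (double_scale scale c x) = double_scale scale c (r.untwist x)" for c x
      by (simp add: r.untwist_def double_scale_def r.sharp_scale case_prod_unfold
          scale_right_distrib)
  \<comment> \<open>What is left is closure of the product and multiplicativity of
    \<open>untwist\<close>; the latter is where the Yang-Baxter equation enters.\<close>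
  qed (use r.double_mult_closed r.untwist_hom assms(4) in \<open>simp_all add: tensor\<close>)
  moreover have "r \<in> tensor2 scale" by (simp add: r tensor2_def quotient_space_def)
  ultimately show ?thesis
    using assms(2) linear_comult_comult_of[OF nonassoc_algebra_axioms]
    by (simp add: malcev_bialgebra_def)
qed

end
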